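(* For any real $\xi\ge0$, there exists a point $x_0\in[0,1)$ such that $\gamma(x_0)=\xi$.
   Context: For irrational $x\in[0,1)$ with continued fraction expansion $x=[a_1(x),a_2(x),\dots]=\cfrac1{a_1(x)+\cfrac1{a_2(x)+\ddots}}$ (the $a_n(x)$ being positive integers), the Khintchine exponent is $\gamma(x)=\lim_{n\to\infty}\frac1n\sum_{j=1}^n\log a_j(x)$ when the limit exists. *)

theory Defs
  imports Complex_Main
begin

text \<open>The finite continued fraction \<open>1 / (a\<^sub>1 + 1 / (a\<^sub>2 + \<dots> + 1 / a\<^sub>n))\<close>.\<close>

fun cf_finite :: "nat list \<Rightarrow> real" where
  "cf_finite [] = 0"
| "cf_finite (a # as) = 1 / (real a + cf_finite as)"

text \<open>Digit sequences are indexed from 1; the value \<open>a 0\<close> is irrelevant throughout.\<close>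

definition cf_expansion :: "(nat \<Rightarrow> nat) \<Rightarrow> real \<Rightarrow> bool" where
  "cf_expansion a x \<longleftrightarrow>
     (\<forall>n\<ge>1. 1 \<le> a n) \<and> (\<lambda>n. cf_finite (map a [1..<Suc n])) \<longlonglongrightarrow> x"

text \<open>
  The definite description is meaningful for irrational \<open>x\<close> in \<open>[0, 1)\<close> and \<open>n \<ge> 1\<close>,
  since such an \<open>x\<close> has exactly one continued fraction expansion.
\<close>

definition partial_quotient :: "real \<Rightarrow> nat \<Rightarrow> nat" where
  "partial_quotient x n = (THE k. \<exists>a. cf_expansion a x \<and> a n = k)"

definition khintchine_mean :: "real \<Rightarrow> nat \<Rightarrow> real" where
  "khintchine_mean x n = (1 / real n) * (\<Sum>j=1..n. ln (real (partial_quotient x j)))"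

text \<open>Only meaningful when \<open>khintchine_mean x\<close> converges.\<close>

definition khintchine_exponent :: "real \<Rightarrow> real" where
  "khintchine_exponent x = lim (khintchine_mean x)"

end

theory Submission
  imports Defs
begin

text \<open>
  With \<open>k n = \<lfloor>n \<xi> / ln 2\<rfloor>\<close> and digits \<open>a n = 2 ^ (k n - k (n - 1))\<close>, the sum of the first
  \<open>n\<close> logarithms telescopes to \<open>k n ln 2 = n \<xi> + O(1)\<close>. Any sequence of positive digits
  expands a point of \<open>(0, 1)\<close>, because two continued fraction steps contract distances by a
  factor 4. The tail \<open>1 / x - a\<^sub>1\<close> lies in \<open>(0, 1)\<close> again, so the digits are determined by the
  point; and a rational point would give an infinite descent of denominators.
\<close>

lemma cf_finite_bounds:
  assumes "\<forall>k\<in>set as. 1 \<le> k"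
  shows "0 \<le> cf_finite as \<and> cf_finite as \<le> 1"
  using assms
proof (induction as)
  case (Cons k as)
  then have "0 \<le> cf_finite as" "1 \<le> real k" by auto
  then show ?case by (simp add: field_simps)
qed simp

lemma cf_two_steps_contract:
  fixes k l s t :: real
  assumes "1 \<le> k" "1 \<le> l" "0 \<le> s" "0 \<le> t"
  shows "\<bar>1 / (k + 1 / (l + s)) - 1 / (k + 1 / (l + t))\<bar> \<le> \<bar>s - t\<bar> / 4"
proof -
  define u v where "u = k * (l + s) + 1" and "v = k * (l + t) + 1"
  have "1 * 1 \<le> k * (l + s)" "1 * 1 \<le> k * (l + t)"
    using assms by (intro mult_mono; simp)+
  then have uv: "2 \<le> u" "2 \<le> v" by (auto simp: u_def v_def)
  then have "2 * 2 \<le> u * v" by (intro mult_mono) auto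
  have "1 / (k + 1 / (l + s)) = (l + s) / u" "1 / (k + 1 / (l + t)) = (l + t) / v"
    using assms by (auto simp: u_def v_def field_simps)
  moreover have "(l + s) / u - (l + t) / v = (s - t) / (u * v)"
    using uv by (simp add: field_simps) (simp add: u_def v_def algebra_simps)
  ultimately have "\<bar>1 / (k + 1 / (l + s)) - 1 / (k + 1 / (l + t))\<bar> = \<bar>s - t\<bar> / (u * v)"
    using uv by (simp add: abs_mult)
  also have "\<dots> \<le> \<bar>s - t\<bar> / 4"
    using \<open>2 * 2 \<le> u * v\<close> by (intro divide_left_mono) auto
  finally show ?thesis .
qed

lemma cf_finite_common_prefix:
  assumes "\<forall>k\<in>set as \<union> set bs \<union> set cs. 1 \<le> k"
  shows "\<bar>cf_finite (as @ bs) - cf_finite (as @ cs)\<bar> \<le> 2 * (1 / 2) ^ length as"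
  using assms
proof (induction as rule: induct_list012)
  case 1
  then show ?case using cf_finite_bounds[of bs] cf_finite_bounds[of cs] by auto
next
  case (2 k)
  then show ?case
    using cf_finite_bounds[of "k # bs"] cf_finite_bounds[of "k # cs"]
    by (auto simp del: cf_finite.simps)
next
  case (3 k l as)
  have "0 \<le> cf_finite (as @ bs)" "0 \<le> cf_finite (as @ cs)"
    using 3(3) cf_finite_bounds[of "as @ bs"] cf_finite_bounds[of "as @ cs"] by auto
  then have "\<bar>cf_finite ((k # l # as) @ bs) - cf_finite ((k # l # as) @ cs)\<bar>
      \<le> \<bar>cf_finite (as @ bs) - cf_finite (as @ cs)\<bar> / 4"
    using cf_two_steps_contract[of "real k" "real l"] 3(3) by simp
  also have "\<dots> \<le> 2 * (1 / 2) ^ length as / 4"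
    using 3 by (intro divide_right_mono) auto
  finally show ?case by simp
qed

lemma cf_expansion_exists:
  assumes "\<forall>n\<ge>1. 1 \<le> a n"
  obtains x where "cf_expansion a x"
proof -
  let ?c = "\<lambda>n. cf_finite (map a [1..<Suc n])"
  have near: "\<bar>?c m - ?c n\<bar> \<le> 2 * (1 / 2) ^ N" if "N \<le> m" "N \<le> n" for N m n
  proof -
    have split: "map a [1..<Suc j] = map a [1..<Suc N] @ map a [Suc N..<Suc j]" if "N \<le> j" for j
      unfolding map_append[symmetric]
      using upt_add_eq_append[of 1 "Suc N" "j - N"] that by (simp del: upt_Suc)
    have "\<forall>k\<in>set (map a [1..<Suc N]) \<union> set (map a [Suc N..<Suc m]) \<union> set (map a [Suc N..<Suc n]). 1 \<le> k"
      using assms by (auto simp del: upt_Suc)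
    from cf_finite_common_prefix[OF this] show ?thesis
      unfolding split[OF that(1)] split[OF that(2)] by (simp del: upt_Suc)
  qed
  have "Cauchy ?c"
  proof (rule CauchyI)
    fix e :: real
    assume "0 < e"
    then obtain N where "(1 / 2 :: real) ^ N < e / 2"
      using real_arch_pow_inv[of "e / 2" "1 / 2"] by auto
    then have "2 * (1 / 2) ^ N < e" by simp
    then have "norm (?c m - ?c n) < e" if "N \<le> m" "N \<le> n" for m n
      using near[OF that] unfolding real_norm_def by linarith
    then show "\<exists>N. \<forall>m\<ge>N. \<forall>n\<ge>N. norm (?c m - ?c n) < e" by blast
  qed
  then obtain x where "?c \<longlonglongrightarrow> x"
    using Cauchy_convergent convergentD by blast
  with assms that show thesis by (simp add: cf_expansion_def)
qed

lemma cf_expansion_tail_nonneg: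
  assumes "cf_expansion a x"
  obtains y where "cf_expansion (a \<circ> Suc) y" "0 \<le> y" "y \<le> 1" "x = 1 / (real (a 1) + y)"
proof -
  have pos: "\<forall>n\<ge>1. 1 \<le> a n" using assms by (simp add: cf_expansion_def)
  obtain y where y: "cf_expansion (a \<circ> Suc) y"
    using cf_expansion_exists[of "a \<circ> Suc"] pos by auto
  let ?c = "\<lambda>n. cf_finite (map (a \<circ> Suc) [1..<Suc n])"
  have lim: "?c \<longlonglongrightarrow> y" using y by (simp add: cf_expansion_def)
  have bounds: "0 \<le> ?c n \<and> ?c n \<le> 1" for n
    using pos by (intro cf_finite_bounds) auto
  have "0 \<le> y" using bounds by (intro LIMSEQ_le_const[OF lim]) blast
  have "y \<le> 1" using bounds by (intro LIMSEQ_le_const2[OF lim]) blast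
  have "1 \<le> a 1" using pos by blast
  have "cf_finite (map a [1..<Suc (Suc n)]) = 1 / (real (a 1) + ?c n)" for n
  proof -
    have "[1..<Suc (Suc n)] = 1 # map Suc [1..<Suc n]"
      unfolding map_Suc_upt by (simp add: upt_conv_Cons)
    then show ?thesis by (simp only: map_map list.map cf_finite.simps)
  qed
  moreover have "(\<lambda>n. 1 / (real (a 1) + ?c n)) \<longlonglongrightarrow> 1 / (real (a 1) + y)"
    using \<open>0 \<le> y\<close> \<open>1 \<le> a 1\<close> by (intro tendsto_intros lim) auto
  moreover have "(\<lambda>n. cf_finite (map a [1..<Suc (Suc n)])) \<longlonglongrightarrow> x"
    using assms unfolding cf_expansion_def by (blast intro: LIMSEQ_Suc[of "\<lambda>n. cf_finite (map a [1..<Suc n])"])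
  ultimately have "x = 1 / (real (a 1) + y)" by (simp add: LIMSEQ_unique)
  with y \<open>0 \<le> y\<close> \<open>y \<le> 1\<close> that show thesis by blast
qed

lemma cf_expansion_in_unit_interval:
  assumes "cf_expansion a x"
  shows "0 < x" "x < 1"
proof -
  have pos: "0 < x" if x: "cf_expansion a x" for a x
  proof -
    obtain y where "0 \<le> y" "x = 1 / (real (a 1) + y)"
      using cf_expansion_tail_nonneg[OF x] by metis
    moreover have "1 \<le> a 1" using x by (simp add: cf_expansion_def)
    ultimately show ?thesis by simp
  qed
  from pos[OF assms] show "0 < x" .
  obtain y where y: "cf_expansion (a \<circ> Suc) y" "x = 1 / (real (a 1) + y)"
    using cf_expansion_tail_nonneg[OF assms] by metis
  moreover have "1 \<le> real (a 1)" using assms by (simp add: cf_expansion_def)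
  ultimately show "x < 1" using pos[OF y(1)] by simp
qed

lemma cf_expansion_tail:
  assumes "cf_expansion a x"
  shows "cf_expansion (a \<circ> Suc) (1 / x - real (a 1))"
proof -
  obtain y where "cf_expansion (a \<circ> Suc) y" "x = 1 / (real (a 1) + y)"
    using cf_expansion_tail_nonneg[OF assms] by metis
  then show ?thesis by simp
qed

lemma cf_expansion_first_digit:
  assumes "cf_expansion a x"
  shows "\<lfloor>1 / x\<rfloor> = int (a 1)"
  using cf_expansion_in_unit_interval[OF cf_expansion_tail[OF assms]]
  by (intro floor_unique) auto

lemma cf_expansion_unique:
  assumes "cf_expansion a x" "cf_expansion b x" "1 \<le> n"
  shows "a n = b n"
  using assms(3,1,2)
proof (induction n arbitrary: a b x rule: nat_induct_at_least)
  case base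
  then show ?case
    using cf_expansion_first_digit[OF base(1)] cf_expansion_first_digit[OF base(2)] by simp
next
  case (Suc n)
  have "a 1 = b 1"
    using cf_expansion_first_digit[OF Suc.prems(1)] cf_expansion_first_digit[OF Suc.prems(2)]
    by simp
  then show ?case
    using Suc.IH[OF cf_expansion_tail[OF Suc.prems(1)]] cf_expansion_tail[OF Suc.prems(2)]
    by (metis comp_apply)
qed

lemma cf_expansion_irrational:
  assumes "cf_expansion a x"
  shows "x \<notin> \<rat>"
proof
  have no_fraction: "\<not> cf_expansion a (real_of_int p / real q)" for a p q
  proof (induction q arbitrary: a p rule: less_induct)
    case (less q)
    show ?case
    proof
      assume x: "cf_expansion a (real_of_int p / real q)"
      note bounds = cf_expansion_in_unit_interval[OF x]
      have "0 < q" using bounds(1) by (cases q) auto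
      have "0 < p" "p < int q"
        using bounds \<open>0 < q\<close> by (auto simp: zero_less_divide_iff divide_less_eq)
      then have "1 / (real_of_int p / real q) - real (a 1)
          = real_of_int (int q - int (a 1) * p) / real (nat p)"
        by (simp add: field_simps)
      moreover have "nat p < q" using \<open>p < int q\<close> \<open>0 < q\<close> by linarith
      ultimately show False using cf_expansion_tail[OF x] less[of "nat p"] by metis
    qed
  qed
  assume "x \<in> \<rat>"
  then obtain p q where "0 < q" "x = real_of_int p / real_of_int q"
    by (elim Rats_cases')
  with no_fraction[of a p "nat q"] assms show False by simp
qed

lemma partial_quotient_eq:
  assumes "cf_expansion a x" "1 \<le> n"
  shows "partial_quotient x n = a n"
  unfolding partial_quotient_def
  using assms cf_expansion_unique by (intro the_equality) blast+

lemma exists_digits_log_mean: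
  fixes \<xi> :: real
  assumes "0 \<le> \<xi>"
  obtains a :: "nat \<Rightarrow> nat" where "\<forall>n\<ge>1. 1 \<le> a n"
    and "(\<lambda>n. 1 / real n * (\<Sum>j=1..n. ln (real (a j)))) \<longlonglongrightarrow> \<xi>"
proof
  define \<theta> where "\<theta> = \<xi> / ln 2"
  have "0 \<le> \<theta>" using assms by (simp add: \<theta>_def)
  define k where "k n = nat \<lfloor>real n * \<theta>\<rfloor>" for n
  define a :: "nat \<Rightarrow> nat" where "a n = 2 ^ (k n - k (n - 1))" for n
  show "\<forall>n\<ge>1. 1 \<le> a n" by (simp add: a_def)
  have mono: "k n \<le> k (Suc n)" for n
    using \<open>0 \<le> \<theta>\<close> unfolding k_def by (intro nat_mono floor_mono mult_right_mono) auto
  have sum: "(\<Sum>j=1..n. ln (real (a j))) = real (k n) * ln 2" for n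
  proof (induction n)
    case (Suc n)
    then show ?case
      using mono[of n] by (simp add: a_def ln_realpow of_nat_diff algebra_simps)
  qed (simp add: k_def)
  have k_bounds: "real n * \<theta> - 1 \<le> real (k n)" "real (k n) \<le> real n * \<theta>" for n
    using \<open>0 \<le> \<theta>\<close> by (simp_all add: k_def)
  have "(\<lambda>n. real (k n) / real n) \<longlonglongrightarrow> \<theta>"
  proof (rule tendsto_sandwich)
    have "(\<lambda>n. \<theta> - 1 / real n) \<longlonglongrightarrow> \<theta> - 0"
      by (intro tendsto_diff tendsto_const lim_1_over_n)
    then show "(\<lambda>n. \<theta> - 1 / real n) \<longlonglongrightarrow> \<theta>" by simp
    show "(\<lambda>n. \<theta>) \<longlonglongrightarrow> \<theta>" by simp
    show "\<forall>\<^sub>F n in sequentially. \<theta> - 1 / real n \<le> real (k n) / real n"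
    proof (rule eventually_mono[OF eventually_gt_at_top[of 0]])
      fix n :: nat
      assume "0 < n"
      then have "\<theta> - 1 / real n = (real n * \<theta> - 1) / real n" by (simp add: field_simps)
      with k_bounds(1)[of n] show "\<theta> - 1 / real n \<le> real (k n) / real n"
        by (simp add: divide_right_mono)
    qed
    show "\<forall>\<^sub>F n in sequentially. real (k n) / real n \<le> \<theta>"
      using eventually_gt_at_top[of 0]
      by eventually_elim (use k_bounds in \<open>simp add: field_simps\<close>)
  qed
  then have "(\<lambda>n. real (k n) / real n * ln 2) \<longlonglongrightarrow> \<theta> * ln 2"
    by (intro tendsto_intros)
  then show "(\<lambda>n. 1 / real n * (\<Sum>j=1..n. ln (real (a j)))) \<longlonglongrightarrow> \<xi>"
    unfolding sum by (simp add: \<theta>_def)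
qed

theorem proposition2p9:
  fixes \<xi> :: real
  assumes "\<xi> \<ge> 0"
  shows "\<exists>x\<^sub>0 \<in> {0..<1::real}. x\<^sub>0 \<notin> \<rat> \<and>
           convergent (khintchine_mean x\<^sub>0) \<and> khintchine_exponent x\<^sub>0 = \<xi>"
proof -
  obtain a :: "nat \<Rightarrow> nat" where pos: "\<forall>n\<ge>1. 1 \<le> a n"
    and mean: "(\<lambda>n. 1 / real n * (\<Sum>j=1..n. ln (real (a j)))) \<longlonglongrightarrow> \<xi>"
    using exists_digits_log_mean[OF assms] .
  obtain x where x: "cf_expansion a x" using cf_expansion_exists[OF pos] .
  have "khintchine_mean x = (\<lambda>n. 1 / real n * (\<Sum>j=1..n. ln (real (a j))))"
    by (simp add: fun_eq_iff khintchine_mean_def partial_quotient_eq[OF x])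
  with mean have "khintchine_mean x \<longlonglongrightarrow> \<xi>" by simp
  then show ?thesis
    using cf_expansion_in_unit_interval[OF x] cf_expansion_irrational[OF x]
    by (intro bexI[of _ x]) (auto simp: khintchine_exponent_def convergentI limI)
qed

end
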